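(* Let $S_n$ be a random walk on a partitioned sample space $\Omega = A \sqcup B \sqcup C$. For $a,a'\in A$ and $b,b'\in B$, with $\psi_a,\sigma_b,\rho_a,\phi_b$ and the truncated Green's functions $G_A, G_B, G_{A\cup B}$ as defined in the context, we have the Green's function bounds $$G_A(a,a') \le G_{A\cup B}(a,a') \le G_A(a,a') + \frac{\rho_a}{1-\rho_{a'}}\,G_A(a',a'),$$ $$G_B(b,b') \le G_{A\cup B}(b,b') \le G_B(b,b') + \frac{\phi_b}{1-\phi_{b'}}\,G_B(b',b'),$$ $$0\le G_{A\cup B}(a,b)\le \min\left\{\frac{\sigma_b}{1-\rho_a}\,G_A(a,a),\ \frac{\psi_a}{1-\phi_b}\,G_B(b,b)\right\}.$$
   Context: $S_n = x+\sum_{j=1}^n X_j$ is a random walk starting at $x$ on a sample space $\Omega$ partitioned as $\Omega = A\sqcup B\sqcup C$. $P^x$ and $\mathbb{E}^x$ denote the probability measure and expectation of the random walk starting at $x$, and $p_1(x,y)=P^x(S_1=y)$ is the one-step transition probability for $x,y\in\Omega$. For a set $D\subset\Omega$, the first hitting time is $T_D := \inf\{k\ge 0: S_k\in D\}$. For a starting point $x\in D^c$, the hitting distribution of $D$ is $H_D(x,y) := P^x(S_{T_D}=y)$. The truncated Green's function is, for $x,y\in D$, $$G_D(x,y) := \mathbb{E}^x\Big[\sum_{j=0}^\infty 1_{\{S_j=y;\ j<T_{D^c}\}}\Big] = \sum_{j=0}^\infty P^x(S_j=y;\ j<T_{D^c}),$$ and $G_D(x,y)=0$ if $x\notin D$ or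 $y\notin D$. With $\theta_t$ the usual shift operators, set $$T^*_B := \inf\{k>T_A: S_k\in B\}=T_A+T_B\circ\theta_{T_A},\qquad T^*_A := \inf\{k>T_B: S_k\in A\}=T_B+T_A\circ\theta_{T_B}.$$ For $a\in A$ and $b\in B$ define $$\psi_a := \sum_{b'\in B} H_{B\cup C}(a,b') = P^a(T_B<T_C),\qquad \sigma_b := \sum_{a'\in A} H_{A\cup C}(b,a') = P^b(T_A<T_C),$$ $$\rho_a := \sum_{b'\in B} H_{B\cup C}(a,b')\,\sigma_{b'} = P^a(T_B, T^*_A<T_C),\qquad \phi_b := \sum_{a'\in A} H_{A\cup C}(b,a')\,\psi_{a'} = P^b(T_A, T^*_B<T_C),$$ where $P^a(T_B,T^*_A<T_C)$ means the probability that both $T_B<T_C$ and $T^*_A<T_C$, and similarly for $P^b(T_A,T^*_B<T_C)$.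
   Formalization: The bound of G_{A∪B}(a,b) by σ_b/(1−ρ_a)·G_A(a,a) is proved only for symmetric walks, p_1(x,y)=p_1(y,x); without symmetry it is false (steps always +1 on the integers, A={0}, B={1}). All other bounds hold for every walk. *)

theory Defs
  imports "HOL-Probability.Probability"
begin

text \<open>
  The state space \<open>\<Omega>\<close> is the universe of a countable abelian group type. One i.i.d. sequence of
  increments serves all starting points: \<open>P\<^sup>x\<close> of an event about the walk is the
  \<open>M\<close>-probability of that event for \<open>walk X x\<close>.
\<close>

locale random_walk = prob_space M
  for M :: "'w measure" and X :: "nat \<Rightarrow> 'w \<Rightarrow> 'a :: {ab_group_add, countable}" +
  assumes indep_steps: "indep_vars (\<lambda>_. count_space UNIV) X UNIV"
    and ident_distr_steps: "\<And>j. distr M (count_space UNIV) (X j) = distr M (count_space UNIV) (X 0)"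

text \<open>\<open>X j\<close> is the increment of step number \<open>j + 1\<close>.\<close>

definition walk :: "(nat \<Rightarrow> 'w \<Rightarrow> 'a::ab_group_add) \<Rightarrow> 'a \<Rightarrow> nat \<Rightarrow> 'w \<Rightarrow> 'a" where
  "walk X x n \<omega> = x + (\<Sum>j<n. X j \<omega>)"

definition step_prob :: "'w measure \<Rightarrow> (nat \<Rightarrow> 'w \<Rightarrow> 'a::ab_group_add) \<Rightarrow> 'a \<Rightarrow> 'a \<Rightarrow> ennreal" where
  "step_prob M X x y = emeasure M {\<omega> \<in> space M. walk X x 1 \<omega> = y}"

text \<open>Symmetry gives \<open>G\<^sub>D(x, y) = G\<^sub>D(y, x)\<close>. Without it, the bound
  \<open>G(a, b) \<le> \<sigma>\<^sub>b / (1 - \<rho>\<^sub>a) * G\<^sub>A(a, a)\<close> for \<open>G\<close> on \<open>A \<union> B\<close> fails, e.g. for the deterministic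
  walk with step \<open>+1\<close> on the integers and \<open>A = {0}\<close>, \<open>B = {1}\<close>.\<close>

definition symmetric_walk :: "'w measure \<Rightarrow> (nat \<Rightarrow> 'w \<Rightarrow> 'a::ab_group_add) \<Rightarrow> bool" where
  "symmetric_walk M X \<longleftrightarrow> (\<forall>x y. step_prob M X x y = step_prob M X y x)"

text \<open>The hitting time is \<open>\<infinity>\<close> if the set is never reached, since \<open>Inf {} = \<infinity>\<close> in \<^typ>\<open>enat\<close>.\<close>

definition hitting_time ::
    "(nat \<Rightarrow> 'w \<Rightarrow> 'a::ab_group_add) \<Rightarrow> 'a \<Rightarrow> 'a set \<Rightarrow> 'w \<Rightarrow> enat" where
  "hitting_time X x D \<omega> = Inf (enat ` {k. walk X x k \<omega> \<in> D})"

text \<open>The event \<open>S\<^bsub>T\<^esub> = y\<close> includes that the hitting time \<open>T\<close> is finite, so the total mass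
  may be less than 1.\<close>

definition hitting_distr ::
    "'w measure \<Rightarrow> (nat \<Rightarrow> 'w \<Rightarrow> 'a::ab_group_add) \<Rightarrow> 'a set \<Rightarrow> 'a \<Rightarrow> 'a \<Rightarrow> ennreal" where
  "hitting_distr M X D x y =
     emeasure M {\<omega> \<in> space M. \<exists>k. hitting_time X x D \<omega> = enat k \<and> walk X x k \<omega> = y}"

definition green ::
    "'w measure \<Rightarrow> (nat \<Rightarrow> 'w \<Rightarrow> 'a::ab_group_add) \<Rightarrow> 'a set \<Rightarrow> 'a \<Rightarrow> 'a \<Rightarrow> ennreal" where
  "green M X D x y =
     (if x \<in> D \<and> y \<in> D
      then \<integral>\<^sup>+ \<omega>. (\<Sum>j. indicator {\<omega>. walk X x j \<omega> = y \<and> enat j < hitting_time X x (- D) \<omega>} \<omega>) \<partial>M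
      else 0)"

definition hit_psi ::
    "'w measure \<Rightarrow> (nat \<Rightarrow> 'w \<Rightarrow> 'a::ab_group_add) \<Rightarrow> 'a set \<Rightarrow> 'a set \<Rightarrow> 'a set \<Rightarrow> 'a \<Rightarrow> ennreal" where
  "hit_psi M X A B C a = (\<Sum>\<^sub>\<infinity>b'\<in>B. hitting_distr M X (B \<union> C) a b')"

definition hit_sigma ::
    "'w measure \<Rightarrow> (nat \<Rightarrow> 'w \<Rightarrow> 'a::ab_group_add) \<Rightarrow> 'a set \<Rightarrow> 'a set \<Rightarrow> 'a set \<Rightarrow> 'a \<Rightarrow> ennreal" where
  "hit_sigma M X A B C b = (\<Sum>\<^sub>\<infinity>a'\<in>A. hitting_distr M X (A \<union> C) b a')"

definition hit_rho ::
    "'w measure \<Rightarrow> (nat \<Rightarrow> 'w \<Rightarrow> 'a::ab_group_add) \<Rightarrow> 'a set \<Rightarrow> 'a set \<Rightarrow> 'a set \<Rightarrow> 'a \<Rightarrow> ennreal" where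
  "hit_rho M X A B C a = (\<Sum>\<^sub>\<infinity>b'\<in>B. hitting_distr M X (B \<union> C) a b' * hit_sigma M X A B C b')"

definition hit_phi ::
    "'w measure \<Rightarrow> (nat \<Rightarrow> 'w \<Rightarrow> 'a::ab_group_add) \<Rightarrow> 'a set \<Rightarrow> 'a set \<Rightarrow> 'a set \<Rightarrow> 'a \<Rightarrow> ennreal" where
  "hit_phi M X A B C b = (\<Sum>\<^sub>\<infinity>a'\<in>A. hitting_distr M X (A \<union> C) b a' * hit_psi M X A B C a')"

text \<open>
  Green's functions may be infinite, so all these quantities, and the bounds between them, live in
  \<^typ>\<open>ennreal\<close>. There \<open>0 / 0 = 0\<close> and \<open>c / 0 = \<infinity>\<close> for \<open>c > 0\<close>, which is how a fraction such as
  \<open>\<rho>\<^sub>a / (1 - \<rho>\<^sub>a')\<close> is read when \<open>\<rho>\<^sub>a' = 1\<close>; and \<open>0 * \<infinity> = 0\<close>.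
\<close>

end

theory Submission imports Defs begin

text \<open>
  Decompose paths inside \<open>A \<union> B\<close> at the first entry into \<open>B\<close> and the next return to \<open>A\<close>. Since
  \<open>G(x, y) \<le> G(y, y)\<close> for every Green's function, this gives
  \<open>G\<^bsub>A\<union>B\<^esub>(a, a') \<le> G\<^sub>A(a, a') + \<rho>\<^sub>a * G\<^bsub>A\<union>B\<^esub>(a', a')\<close>, and \<open>a = a'\<close> turns it into
  \<open>G\<^bsub>A\<union>B\<^esub>(a', a') \<le> G\<^sub>A(a', a') / (1 - \<rho>\<^bsub>a'\<^esub>)\<close>. In the same way, first entry into \<open>B\<close>
  gives \<open>G\<^bsub>A\<union>B\<^esub>(a, b) \<le> \<psi>\<^sub>a * G\<^bsub>A\<union>B\<^esub>(b, b)\<close>.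
\<close>

section \<open>Infinite sums as integrals\<close>

text \<open>Gives the sums that define psi, sigma, rho and phi access to linearity and monotonicity
  of the integral. Both sides are limits of finite partial sums.\<close>

lemma infsum_ennreal_eq_nn_integral:
  fixes f :: "'a::countable \<Rightarrow> ennreal"
  shows "infsum f A = (\<integral>\<^sup>+x. f x \<partial>count_space A)"
proof (rule antisym)
  have "sum f F \<le> (\<integral>\<^sup>+x. f x \<partial>count_space A)" if "finite F" "F \<subseteq> A" for F
  proof -
    have "sum f F = (\<integral>\<^sup>+x. f x \<partial>count_space F)"
      using that by (simp add: nn_integral_count_space_finite)
    also have "\<dots> \<le> (\<integral>\<^sup>+x. f x \<partial>count_space A)"
      using that by (subst (1 2) nn_integral_count_space_indicator)
        (auto intro!: nn_integral_mono split: split_indicator)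
    finally show ?thesis .
  qed
  then show "infsum f A \<le> (\<integral>\<^sup>+x. f x \<partial>count_space A)"
    unfolding nonneg_infsum_complete[where A=A and f=f, OF zero_le] by (rule SUP_least) auto
next
  \<comment> \<open>The injection \<open>to_nat\<close> exhausts \<open>A\<close> by an increasing
    sequence of finite sets, as monotone convergence requires.\<close>
  define F where "F n = {x \<in> A. to_nat x < n}" for n
  have fin: "finite (F n)" for n
    unfolding F_def by (rule finite_subset[OF _ finite_vimageI[of "{..<n}" to_nat]]) auto
  have "(\<integral>\<^sup>+x. f x \<partial>count_space A) = (\<integral>\<^sup>+x. (SUP n. f x * indicator (F n) x) \<partial>count_space A)"
  proof (rule nn_integral_cong)
    fix x assume x: "x \<in> space (count_space A)"
    have "f x \<le> (SUP n. f x * indicator (F n) x)"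
      using x by (intro SUP_upper2[of "Suc (to_nat x)"]) (auto simp: F_def)
    moreover have "(SUP n. f x * indicator (F n) x) \<le> f x"
      by (intro SUP_least) (auto split: split_indicator)
    ultimately show "f x = (SUP n. f x * indicator (F n) x)" by (rule antisym)
  qed
  also have "\<dots> = (SUP n. \<integral>\<^sup>+x. f x * indicator (F n) x \<partial>count_space A)"
    by (rule nn_integral_monotone_convergence_SUP)
      (auto simp: incseq_def le_fun_def F_def split: split_indicator)
  also have "\<dots> = (SUP n. sum f (F n))"
  proof (rule SUP_cong[OF refl])
    fix n
    have "(\<integral>\<^sup>+x. f x * indicator (F n) x \<partial>count_space A) = (\<integral>\<^sup>+x. f x \<partial>count_space (F n))"
      by (subst (1 2) nn_integral_count_space_indicator)
        (auto intro!: nn_integral_cong simp: F_def split: split_indicator)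
    then show "(\<integral>\<^sup>+x. f x * indicator (F n) x \<partial>count_space A) = sum f (F n)"
      using fin by (simp add: nn_integral_count_space_finite)
  qed
  also have "\<dots> \<le> infsum f A"
    unfolding nonneg_infsum_complete[where A=A and f=f, OF zero_le] using fin
    by (intro SUP_least SUP_upper) (auto simp: F_def)
  finally show "(\<integral>\<^sup>+x. f x \<partial>count_space A) \<le> infsum f A" .
qed

section \<open>Positions and hitting times\<close>

lemma walk_Suc: "walk X x (Suc n) \<omega> = walk X x n \<omega> + X n \<omega>"
  by (simp add: walk_def add.assoc)

lemma less_hitting_time_iff:
  "enat n < hitting_time X x D \<omega> \<longleftrightarrow> (\<forall>k\<le>n. walk X x k \<omega> \<notin> D)"
proof -
  \<comment> \<open>The non-strict form is what \<open>le_Inf_iff\<close> can unfold.\<close>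
  have "enat n < hitting_time X x D \<omega> \<longleftrightarrow> enat (Suc n) \<le> hitting_time X x D \<omega>"
    by (metis Suc_ile_eq)
  then show ?thesis
    unfolding hitting_time_def le_Inf_iff by (simp add: Suc_le_eq) (meson not_less)
qed

lemma hitting_time_eq_iff:
  "hitting_time X x D \<omega> = enat n \<longleftrightarrow> (\<forall>k<n. walk X x k \<omega> \<notin> D) \<and> walk X x n \<omega> \<in> D"
proof -
  have "hitting_time X x D \<omega> = enat n \<longleftrightarrow>
      \<not> enat n < hitting_time X x D \<omega> \<and> (\<forall>k<n. enat k < hitting_time X x D \<omega>)"
    by (cases "hitting_time X x D \<omega>")
      (auto simp: not_less dest: spec[where P="\<lambda>k. k < n \<longrightarrow> _ k"] intro!: le_antisym leI)
  then show ?thesis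
    unfolding less_hitting_time_iff by (force simp: le_less)
qed

section \<open>Fractions in \<open>ennreal\<close>\<close>

text \<open>Finiteness of \<open>g\<close> allows \<open>r * g\<close> to be subtracted when
  \<open>r < 1\<close>. Otherwise the denominator is 0, and \<open>G \<noteq> 0\<close> makes the
  quotient infinite instead of 0 / 0 = 0.\<close>

lemma ennreal_le_divide_one_minus:
  fixes g G r :: ennreal
  assumes "g \<le> G + r * g" "g < top" "G \<noteq> 0"
  shows "g \<le> G / (1 - r)"
proof (cases "r < 1")
  case True
  then obtain r' where r: "r = ennreal r'" "0 \<le> r'" "r' < 1"
    by (cases r) auto
  obtain g' where g: "g = ennreal g'" "0 \<le> g'"
    using assms(2) by (cases g) auto
  have one_minus: "1 - r = ennreal (1 - r')"
    using r by (simp add: ennreal_minus flip: ennreal_1)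
  show ?thesis
  proof (cases G)
    case (real G')
    with assms(1) r g have "g' \<le> G' + r' * g'"
      by (simp flip: ennreal_mult ennreal_plus)
    then have "g' \<le> G' / (1 - r')"
      using r by (simp add: field_simps)
    then show ?thesis
      using real r g one_minus by (simp add: divide_ennreal ennreal_leI)
  qed (use one_minus in \<open>simp add: ennreal_top_divide\<close>)
next
  case False
  then have "1 - r = 0" by (simp add: diff_eq_0_iff_ennreal not_less)
  with assms(3) show ?thesis by simp
qed

context random_walk
begin

section \<open>Measurability of the walk\<close>

lemma measurable_step: "X j \<in> measurable M (count_space UNIV)"
  using indep_steps by (auto simp: indep_vars_def)

text \<open>Lives on the product space of the first \<open>n\<close> increments, so that
  independence of this block from \<open>X n\<close> can be applied later.\<close>

lemma measurable_partial_sum: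
  fixes x :: 'a and k n :: nat
  assumes "k \<le> n"
  shows "(\<lambda>f. x + (\<Sum>j<k. f j)) \<in> measurable (\<Pi>\<^sub>M i\<in>{..<n}. count_space UNIV) (count_space UNIV)"
  using assms
proof (induction k)
  case (Suc k)
  have comp: "(\<lambda>f. f k) \<in> measurable (\<Pi>\<^sub>M i\<in>{..<n}. count_space (UNIV::'a set)) (count_space UNIV)"
    using Suc.prems by (intro measurable_component_singleton) auto
  \<comment> \<open>The partial sum takes countably many values \<open>s\<close>, so measurability
    for each fixed \<open>s\<close> suffices.\<close>
  have "(\<lambda>f. (\<lambda>s f. s + f k) (x + (\<Sum>j<k. f j)) f)
      \<in> measurable (\<Pi>\<^sub>M i\<in>{..<n}. count_space (UNIV::'a set)) (count_space UNIV)"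
    by (rule measurable_compose_countable)
      (use Suc in \<open>auto intro!: measurable_compose[OF comp]\<close>)
  then show ?case by (simp add: add.assoc)
qed simp

lemma measurable_walk: "walk X x n \<in> measurable M (count_space UNIV)"
proof -
  have "(\<lambda>\<omega>. (\<lambda>f. x + (\<Sum>j<n. f j)) (\<lambda>i\<in>{..<n}. X i \<omega>)) \<in> measurable M (count_space UNIV)"
    by (rule measurable_compose[OF measurable_restrict[OF measurable_step]
          measurable_partial_sum[OF order_refl]])
  then show ?thesis by (simp add: walk_def[abs_def])
qed

lemma sets_walk_event: "{\<omega> \<in> space M. walk X x n \<omega> \<in> D} \<in> sets M"
  using measurable_sets[OF measurable_walk, of D x n] by (simp add: vimage_def Int_def conj_commute)

section \<open>Taboo probabilities and the Markov property\<close>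

text \<open>The end point is left free of the constraint: for \<open>y\<close> in \<open>D\<close>
  these are the terms of the Green's function of \<open>D\<close>, for \<open>y\<close> outside
  \<open>D\<close> those of the hitting distribution of \<open>- D\<close>.\<close>

definition taboo :: "'a set \<Rightarrow> nat \<Rightarrow> 'a \<Rightarrow> 'a \<Rightarrow> ennreal" where
  "taboo D n x y = emeasure M {\<omega> \<in> space M. (\<forall>j<n. walk X x j \<omega> \<in> D) \<and> walk X x n \<omega> = y}"

lemma sets_taboo_event:
  "{\<omega> \<in> space M. (\<forall>j<n. walk X x j \<omega> \<in> D) \<and> walk X x n \<omega> = y} \<in> sets M"
proof -
  have "{\<omega> \<in> space M. \<forall>j\<in>{..<n}. walk X x j \<omega> \<in> D} \<in> sets M"
    by (rule sets.sets_Collect_countable_All'[OF sets_walk_event countableI_type])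
  from sets.sets_Collect_conj[OF sets_walk_event[of x n "{y}"] this]
  show ?thesis by (simp only: Ball_def lessThan_iff singleton_iff)
qed

lemma taboo_le_1: "taboo D n x y \<le> 1"
  unfolding taboo_def by (rule emeasure_le_1)

lemma taboo_0: "taboo D 0 x y = indicator {x} y"
  by (cases "x = y") (simp_all add: taboo_def walk_def emeasure_space_1)

lemma step_prob_eq: "step_prob M X z y = emeasure M {\<omega> \<in> space M. X n \<omega> = y - z}"
proof -
  have "emeasure (distr M (count_space UNIV) (X n)) {y - z}
      = emeasure (distr M (count_space UNIV) (X 0)) {y - z}"
    using ident_distr_steps[of n] by simp
  then have "emeasure M {\<omega> \<in> space M. X n \<omega> = y - z} = emeasure M {\<omega> \<in> space M. X 0 \<omega> = y - z}"
    by (subst (asm) (1 2) emeasure_distr)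
      (auto simp: measurable_step vimage_def Int_def conj_commute)
  then show ?thesis
    by (simp add: step_prob_def walk_def eq_diff_eq add.commute)
qed

text \<open>Markov property at time \<open>n\<close>: the event about the past is a function of the
  increments below \<open>n\<close>, and these are independent of \<open>X n\<close>.\<close>

lemma taboo_step_indep:
  "emeasure M {\<omega> \<in> space M. ((\<forall>j<n. walk X x j \<omega> \<in> D) \<and> walk X x n \<omega> = z) \<and> X n \<omega> = y - z}
    = taboo D n x z * step_prob M X z y"
proof -
  let ?S = "\<lambda>f k. x + (\<Sum>j<k. f j)"
  let ?P = "\<Pi>\<^sub>M i\<in>{..<n}. count_space (UNIV::'a set)"
  let ?Q = "\<Pi>\<^sub>M i\<in>{n}. count_space (UNIV::'a set)"
  let ?past = "\<lambda>\<omega>. \<lambda>i\<in>{..<n}. X i \<omega>" and ?next = "\<lambda>\<omega>. \<lambda>i\<in>{n}. X i \<omega>"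
  let ?U = "{f \<in> space ?P. (\<forall>j\<in>{..<n}. ?S f j \<in> D) \<and> ?S f n \<in> {z}}"
  let ?V = "{f \<in> space ?Q. f n \<in> {y - z}}"
  have indep: "indep_var ?P ?past ?Q ?next"
    by (rule indep_var_restrict[OF indep_steps]) auto
  have S: "{f \<in> space ?P. ?S f k \<in> E} \<in> sets ?P" if "k \<le> n" for k E
    using measurable_sets[OF measurable_partial_sum[OF that], of E x]
    by (simp add: vimage_def Int_def conj_commute)
  have U: "?U \<in> sets ?P"
    by (intro sets.sets_Collect_conj sets.sets_Collect_countable_All' S) auto
  have V: "?V \<in> sets ?Q"
    using measurable_sets[OF measurable_component_singleton[of n "{n}" "\<lambda>_. count_space UNIV"], of "{y - z}"]
    by (simp add: vimage_def Int_def conj_commute)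
  have walk: "?S (?past \<omega>) k = walk X x k \<omega>" if "k \<le> n" for k \<omega>
    using that by (auto simp: walk_def intro!: sum.cong)
  have past: "?past -` ?U \<inter> space M
      = {\<omega> \<in> space M. (\<forall>j<n. walk X x j \<omega> \<in> D) \<and> walk X x n \<omega> = z}"
    using walk by (auto simp: space_PiM)
  have nxt: "?next -` ?V \<inter> space M = {\<omega> \<in> space M. X n \<omega> = y - z}"
    by (auto simp: space_PiM)
  have both: "(\<lambda>\<omega>. (?past \<omega>, ?next \<omega>)) -` (?U \<times> ?V) \<inter> space M
      = {\<omega> \<in> space M. ((\<forall>j<n. walk X x j \<omega> \<in> D) \<and> walk X x n \<omega> = z) \<and> X n \<omega> = y - z}"
    using past nxt by blast
  show ?thesis
    using indep_varD[OF indep U V] unfolding past nxt both taboo_def step_prob_eq[of z y n]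
    by (simp add: emeasure_eq_measure ennreal_mult)
qed

text \<open>Last-step recursion: split by the position \<open>z\<close> at time \<open>n\<close>,
  which is now one of the times constrained to \<open>D\<close>.\<close>

lemma taboo_Suc:
  "taboo D (Suc n) x y = (\<integral>\<^sup>+z. taboo D n x z * step_prob M X z y \<partial>count_space D)"
proof -
  let ?E = "\<lambda>z. {\<omega> \<in> space M. ((\<forall>j<n. walk X x j \<omega> \<in> D) \<and> walk X x n \<omega> = z) \<and> X n \<omega> = y - z}"
  have union: "{\<omega> \<in> space M. (\<forall>j<Suc n. walk X x j \<omega> \<in> D) \<and> walk X x (Suc n) \<omega> = y} = (\<Union>z\<in>D. ?E z)"
  proof (intro set_eqI)
    fix \<omega>
    have "walk X x (Suc n) \<omega> = y \<longleftrightarrow> X n \<omega> = y - walk X x n \<omega>"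
      by (simp add: walk_Suc eq_diff_eq add.commute)
    then show "\<omega> \<in> {\<omega> \<in> space M. (\<forall>j<Suc n. walk X x j \<omega> \<in> D) \<and> walk X x (Suc n) \<omega> = y}
        \<longleftrightarrow> \<omega> \<in> (\<Union>z\<in>D. ?E z)"
      by (auto simp: All_less_Suc)
  qed
  have sets: "?E z \<in> sets M" for z
  proof -
    have "{\<omega> \<in> space M. X n \<omega> = y - z} \<in> sets M"
      using measurable_sets[OF measurable_step, of "{y - z}" n]
      by (simp add: vimage_def Int_def conj_commute)
    from sets.sets_Collect_conj[OF this sets_taboo_event] show ?thesis .
  qed
  have disj: "disjoint_family_on ?E D"
    by (auto simp: disjoint_family_on_def)
  have "taboo D (Suc n) x y = (\<integral>\<^sup>+z. emeasure M (?E z) \<partial>count_space D)"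
    unfolding taboo_def union by (rule emeasure_UN_countable[OF sets _ disj]) simp
  then show ?thesis by (simp only: taboo_step_indep)
qed

section \<open>Series for hitting distributions and Green's functions\<close>

lemma hitting_distr_eq_suminf_taboo:
  assumes "y \<in> E"
  shows "hitting_distr M X E x y = (\<Sum>n. taboo (- E) n x y)"
proof -
  let ?F = "\<lambda>n. {\<omega> \<in> space M. (\<forall>j<n. walk X x j \<omega> \<in> - E) \<and> walk X x n \<omega> = y}"
  have union: "{\<omega> \<in> space M. \<exists>k. hitting_time X x E \<omega> = enat k \<and> walk X x k \<omega> = y} = (\<Union>n. ?F n)"
    using assms by (auto simp: hitting_time_eq_iff)
  have disj: "disjoint_family ?F"
    unfolding disjoint_family_on_def
  proof (intro ballI impI)
    fix m n :: nat
    assume "m \<noteq> n"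
    then consider "m < n" | "n < m" by linarith
    \<comment> \<open>At the smaller of the two times one event puts the walk at \<open>y\<close> in
      \<open>E\<close>, while the other still keeps it outside \<open>E\<close>.\<close>
    then show "?F m \<inter> ?F n = {}" using assms by cases auto
  qed
  have "hitting_distr M X E x y = emeasure M (\<Union>n. ?F n)"
    unfolding hitting_distr_def union ..
  also have "\<dots> = (\<Sum>n. emeasure M (?F n))"
    by (rule suminf_emeasure[OF _ disj, symmetric]) (rule image_subsetI, rule sets_taboo_event)
  finally show ?thesis unfolding taboo_def .
qed

lemma green_eq_suminf_taboo:
  assumes "x \<in> D" "y \<in> D"
  shows "green M X D x y = (\<Sum>n. taboo D n x y)"
proof -
  let ?F = "\<lambda>n. {\<omega>. walk X x n \<omega> = y \<and> enat n < hitting_time X x (- D) \<omega>}"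
  let ?E = "\<lambda>n. {\<omega> \<in> space M. (\<forall>j<n. walk X x j \<omega> \<in> D) \<and> walk X x n \<omega> = y}"
  have E: "?E n \<in> sets M" for n by (rule sets_taboo_event)
  have ind: "indicator (?F n) \<omega> = (indicator (?E n) \<omega> :: ennreal)" if "\<omega> \<in> space M" for n \<omega>
  proof -
    \<comment> \<open>The hitting time constrains the times up to \<open>n\<close>, the taboo event
      only those below \<open>n\<close>; \<open>y \<in> D\<close> accounts for time
      \<open>n\<close>.\<close>
    have "\<omega> \<in> ?F n \<longleftrightarrow> \<omega> \<in> ?E n"
      using assms that by (auto simp: less_hitting_time_iff le_less)
    then show ?thesis by (simp only: indicator_def)
  qed
  have "green M X D x y = (\<integral>\<^sup>+\<omega>. (\<Sum>n. indicator (?E n) \<omega>) \<partial>M)"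
    using assms unfolding green_def by (simp only: if_True simp_thms) (intro nn_integral_cong suminf_cong ind)
  also have "\<dots> = (\<Sum>n. \<integral>\<^sup>+\<omega>. indicator (?E n) \<omega> \<partial>M)"
    by (intro nn_integral_suminf borel_measurable_indicator E)
  also have "\<dots> = (\<Sum>n. taboo D n x y)"
    unfolding taboo_def nn_integral_indicator[OF E] ..
  finally show ?thesis .
qed

section \<open>Decomposition at the first exit\<close>

lemma taboo_mono:
  assumes "D \<subseteq> D'"
  shows "taboo D n x y \<le> taboo D' n x y"
  unfolding taboo_def using assms by (intro emeasure_mono sets_taboo_event) blast

text \<open>Decomposition of a path inside \<open>D'\<close> at its first exit from \<open>D\<close>, which happens at a
  point \<open>z\<close> of \<open>D' - D\<close>. Only this inequality is needed.\<close>

lemma taboo_first_exit: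
  assumes "D \<subseteq> D'" "y \<in> D'"
  shows "taboo D' n x y \<le> taboo D n x y * indicator D y +
    (\<Sum>k\<le>n. \<integral>\<^sup>+z. taboo D k x z * taboo D' (n - k) z y \<partial>count_space (D' - D))"
  using assms(2)
proof (induction n arbitrary: y)
  case 0
  have "taboo D' 0 x y \<le> taboo D 0 x y * indicator D y +
      (\<integral>\<^sup>+z. taboo D 0 x z * taboo D' 0 z y \<partial>count_space (D' - D))"
  proof (cases "y \<in> D")
    case False
    \<comment> \<open>For \<open>y\<close> outside \<open>D\<close> the single point
      \<open>z = y\<close> already supplies the whole left side.\<close>
    with 0 have "taboo D 0 x y * taboo D' 0 y y
        \<le> (\<integral>\<^sup>+z. taboo D 0 x z * taboo D' 0 z y \<partial>count_space (D' - D))"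
      by (intro nn_integral_ge_point) simp
    with False show ?thesis by (simp add: taboo_0)
  qed (simp add: taboo_0)
  then show ?case by simp
next
  case (Suc n)
  let ?p = "step_prob M X"
  let ?I = "\<lambda>n k y. \<integral>\<^sup>+z. taboo D k x z * taboo D' (n - k) z y \<partial>count_space (D' - D)"
  have "taboo D' (Suc n) x y = (\<integral>\<^sup>+w. taboo D' n x w * ?p w y \<partial>count_space D')"
    by (rule taboo_Suc)
  also have "\<dots> \<le> (\<integral>\<^sup>+w. (taboo D n x w * indicator D w + (\<Sum>k\<le>n. ?I n k w)) * ?p w y \<partial>count_space D')"
    by (intro nn_integral_mono mult_right_mono Suc.IH) auto
  also have "\<dots> = (\<integral>\<^sup>+w. taboo D n x w * indicator D w * ?p w y + (\<Sum>k\<le>n. ?I n k w * ?p w y) \<partial>count_space D')"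
    by (simp only: distrib_right sum_distrib_right)
  also have "\<dots> = (\<integral>\<^sup>+w. taboo D n x w * indicator D w * ?p w y \<partial>count_space D')
      + (\<Sum>k\<le>n. \<integral>\<^sup>+w. ?I n k w * ?p w y \<partial>count_space D')"
    by (subst nn_integral_add, simp, simp, subst nn_integral_sum, simp, rule refl)
  \<comment> \<open>Paths still in \<open>D\<close> at time \<open>n\<close>: their last step gives
    the taboo probability at time \<open>Suc n\<close>.\<close>
  also have "(\<integral>\<^sup>+w. taboo D n x w * indicator D w * ?p w y \<partial>count_space D') = taboo D (Suc n) x y"
    unfolding taboo_Suc using assms(1)
    by (subst (1 2) nn_integral_count_space_indicator)
      (auto intro!: nn_integral_cong split: split_indicator)
  \<comment> \<open>Paths that left \<open>D\<close> at a time \<open>k \<le> n\<close>: after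
    Tonelli the last step is absorbed into the part of the path after the exit.\<close>
  also have "(\<Sum>k\<le>n. \<integral>\<^sup>+w. ?I n k w * ?p w y \<partial>count_space D') = (\<Sum>k\<le>n. ?I (Suc n) k y)"
  proof (rule sum.cong[OF refl])
    fix k assume k: "k \<in> {..n}"
    have "(\<integral>\<^sup>+w. ?I n k w * ?p w y \<partial>count_space D')
        = (\<integral>\<^sup>+w. \<integral>\<^sup>+z. taboo D k x z * (taboo D' (n - k) z w * ?p w y) \<partial>count_space (D' - D) \<partial>count_space D')"
      by (simp add: nn_integral_multc[symmetric] mult.assoc)
    also have "\<dots> = (\<integral>\<^sup>+z. \<integral>\<^sup>+w. taboo D k x z * (taboo D' (n - k) z w * ?p w y) \<partial>count_space D' \<partial>count_space (D' - D))"
      by (rule nn_integral_count_space_nn_integral) auto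
    also have "\<dots> = ?I (Suc n) k y"
      using k by (simp add: nn_integral_cmult Suc_diff_le taboo_Suc)
    finally show "(\<integral>\<^sup>+w. ?I n k w * ?p w y \<partial>count_space D') = ?I (Suc n) k y" .
  qed
  \<comment> \<open>The last step either stays in \<open>D\<close> or makes the exit at time
    \<open>Suc n\<close>, and then the exit point is \<open>y\<close> itself.\<close>
  also have "taboo D (Suc n) x y \<le> taboo D (Suc n) x y * indicator D y + ?I (Suc n) (Suc n) y"
  proof (cases "y \<in> D")
    case False
    with Suc.prems have "taboo D (Suc n) x y * taboo D' (Suc n - Suc n) y y \<le> ?I (Suc n) (Suc n) y"
      by (intro nn_integral_ge_point) simp
    with False show ?thesis by (simp add: taboo_0)
  qed simp
  finally show ?case by (simp add: add_ac)
qed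

section \<open>Path reversal and comparison of Green's functions\<close>

text \<open>The last-step recursion and Tonelli yield this by induction, without a second appeal to
  independence. It is the mirror image of \<open>taboo_Suc\<close> that path reversal needs.\<close>

lemma taboo_first_step:
  assumes "x \<in> D" "y \<in> D"
  shows "taboo D (Suc n) x y = (\<integral>\<^sup>+z. step_prob M X x z * taboo D n z y \<partial>count_space D)"
  using assms(2)
proof (induction n arbitrary: y)
  case 0
  have "(\<integral>\<^sup>+z. indicator {x} z * step_prob M X z y \<partial>count_space D)
      = (\<integral>\<^sup>+z. step_prob M X z y * indicator {x} z \<partial>count_space D)"
    by (simp add: mult.commute)
  also have "\<dots> = step_prob M X x y"
    using assms by (subst nn_integral_indicator_singleton) auto
  also have "\<dots> = (\<integral>\<^sup>+z. step_prob M X x z * indicator {y} z \<partial>count_space D)"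
    using 0 by (subst nn_integral_indicator_singleton) auto
  also have "\<dots> = (\<integral>\<^sup>+z. step_prob M X x z * indicator {z} y \<partial>count_space D)"
    by (intro nn_integral_cong) (auto split: split_indicator)
  finally show ?case by (simp only: taboo_Suc taboo_0)
next
  case (Suc n)
  let ?p = "step_prob M X"
  have "taboo D (Suc (Suc n)) x y
      = (\<integral>\<^sup>+w. (\<integral>\<^sup>+z. ?p x z * taboo D n z w \<partial>count_space D) * ?p w y \<partial>count_space D)"
    unfolding taboo_Suc[of D "Suc n"] by (intro nn_integral_cong) (simp add: Suc.IH)
  also have "\<dots> = (\<integral>\<^sup>+w. \<integral>\<^sup>+z. ?p x z * (taboo D n z w * ?p w y) \<partial>count_space D \<partial>count_space D)"
    by (simp add: nn_integral_multc[symmetric] mult.assoc)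
  also have "\<dots> = (\<integral>\<^sup>+z. \<integral>\<^sup>+w. ?p x z * (taboo D n z w * ?p w y) \<partial>count_space D \<partial>count_space D)"
    by (rule nn_integral_count_space_nn_integral) auto
  also have "\<dots> = (\<integral>\<^sup>+z. ?p x z * taboo D (Suc n) z y \<partial>count_space D)"
    by (simp add: nn_integral_cmult taboo_Suc)
  finally show ?case .
qed

text \<open>The last step of a path is the first step of the reversed path, and symmetry gives both
  the same probability.\<close>

lemma taboo_sym:
  assumes "symmetric_walk M X" "x \<in> D" "y \<in> D"
  shows "taboo D n x y = taboo D n y x"
  using assms(2,3)
proof (induction n arbitrary: x y)
  case 0
  then show ?case by (simp add: taboo_0 indicator_def eq_commute)
next
  case (Suc n)
  have "taboo D (Suc n) x y = (\<integral>\<^sup>+z. taboo D n x z * step_prob M X z y \<partial>count_space D)"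
    by (rule taboo_Suc)
  also have "\<dots> = (\<integral>\<^sup>+z. step_prob M X y z * taboo D n z x \<partial>count_space D)"
    using assms(1) Suc by (intro nn_integral_cong) (simp add: symmetric_walk_def mult.commute)
  also have "\<dots> = taboo D (Suc n) y x"
    using Suc.prems by (rule taboo_first_step[symmetric, rotated])
  finally show ?case .
qed

lemma green_sym:
  assumes "symmetric_walk M X"
  shows "green M X D x y = green M X D y x"
proof (cases "x \<in> D \<and> y \<in> D")
  case True
  then show ?thesis by (simp add: green_eq_suminf_taboo taboo_sym[OF assms, of x D y])
qed (auto simp: green_def)

lemma green_mono:
  assumes "D \<subseteq> D'"
  shows "green M X D x y \<le> green M X D' x y"
proof (cases "x \<in> D \<and> y \<in> D")
  case True
  with assms have "x \<in> D'" "y \<in> D'" by auto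
  with True show ?thesis
    by (simp add: green_eq_suminf_taboo suminf_le taboo_mono[OF assms])
qed (auto simp: green_def)

section \<open>Truncated Green's functions\<close>

text \<open>Truncating at time \<open>N\<close> keeps the Green's function finite, so that it can be subtracted.\<close>

definition green_upto :: "'a set \<Rightarrow> nat \<Rightarrow> 'a \<Rightarrow> 'a \<Rightarrow> ennreal" where
  "green_upto D N x y = (\<Sum>n<N. taboo D n x y)"

lemma green_upto_less_top: "green_upto D N x y < top"
proof -
  have "green_upto D N x y \<le> (\<Sum>n<N. 1)"
    unfolding green_upto_def by (intro sum_mono taboo_le_1)
  also have "\<dots> < top" by (simp add: of_nat_less_top)
  finally show ?thesis .
qed

lemma green_upto_le_green:
  assumes "x \<in> D" "y \<in> D"
  shows "green_upto D N x y \<le> green M X D x y"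
  unfolding green_upto_def green_eq_suminf_taboo[OF assms]
  by (rule sum_le_suminf) auto

lemma green_leI:
  assumes "x \<in> D" "y \<in> D" "\<And>N. green_upto D N x y \<le> c"
  shows "green M X D x y \<le> c"
  unfolding green_eq_suminf_taboo[OF assms(1,2)]
  using assms(3) by (intro suminf_le_const) (auto simp: green_upto_def)

text \<open>The visit at time 0 counts. This later rules out a numerator 0 in the fractions.\<close>

lemma green_diag_ge_1:
  assumes "x \<in> D"
  shows "1 \<le> green M X D x x"
  using green_upto_le_green[OF assms assms, of 1] by (simp add: green_upto_def taboo_0)

text \<open>Sums the first-exit decomposition over time. The remaining path keeps the truncation
  \<open>N\<close>, so the same finite quantity can occur on both sides of an inequality.\<close>

lemma green_upto_first_exit:
  assumes "D \<subseteq> D'" "y \<in> D'"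
  shows "green_upto D' N x y \<le> green_upto D N x y * indicator D y +
    (\<integral>\<^sup>+z. hitting_distr M X (- D) x z * green_upto D' N z y \<partial>count_space (D' - D))"
proof -
  let ?u = "\<lambda>k z. taboo D k x z" and ?v = "\<lambda>j z. taboo D' j z y"
  have conv: "(\<Sum>n<N. \<Sum>k\<le>n. ?u k z * ?v (n - k) z) \<le> hitting_distr M X (- D) x z * green_upto D' N z y"
    if "z \<in> - D" for z
  proof -
    have "(\<Sum>n<N. \<Sum>k\<le>n. ?u k z * ?v (n - k) z) = (\<Sum>(k, j)\<in>{(k, j). k + j < N}. ?u k z * ?v j z)"
      by (rule sum.triangle_reindex[symmetric])
    \<comment> \<open>Enlarging the triangle to a square decouples the exit time \<open>k\<close>
      from the remaining time \<open>j\<close>.\<close>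
    also have "\<dots> \<le> (\<Sum>(k, j)\<in>{..<N} \<times> {..<N}. ?u k z * ?v j z)"
      by (rule sum_mono2) auto
    also have "\<dots> = (\<Sum>k<N. ?u k z) * green_upto D' N z y"
      by (simp add: green_upto_def sum_product sum.cartesian_product)
    also have "(\<Sum>k<N. ?u k z) \<le> hitting_distr M X (- D) x z"
      unfolding hitting_distr_eq_suminf_taboo[OF that] double_compl by (rule sum_le_suminf) auto
    finally show ?thesis by (simp add: mult_right_mono)
  qed
  have "green_upto D' N x y \<le> (\<Sum>n<N. taboo D n x y * indicator D y +
      (\<Sum>k\<le>n. \<integral>\<^sup>+z. ?u k z * ?v (n - k) z \<partial>count_space (D' - D)))"
    unfolding green_upto_def by (intro sum_mono taboo_first_exit assms)
  also have "\<dots> = green_upto D N x y * indicator D y +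
      (\<integral>\<^sup>+z. (\<Sum>n<N. \<Sum>k\<le>n. ?u k z * ?v (n - k) z) \<partial>count_space (D' - D))"
    by (simp add: nn_integral_sum sum.distrib green_upto_def sum_distrib_right)
  also have "\<dots> \<le> green_upto D N x y * indicator D y +
      (\<integral>\<^sup>+z. hitting_distr M X (- D) x z * green_upto D' N z y \<partial>count_space (D' - D))"
    by (intro add_left_mono nn_integral_mono conv) auto
  finally show ?thesis .
qed

section \<open>Bounds by crossing probabilities\<close>

text \<open>Within \<open>D\<close>, the first exit from \<open>D - {y}\<close> is the first visit
  to \<open>y\<close>, and its probability is at most 1.\<close>

lemma green_upto_le_diag:
  assumes "y \<in> D"
  shows "green_upto D N x y \<le> green_upto D N y y"
proof -
  have "green_upto D N x y \<le>
      (\<integral>\<^sup>+z. hitting_distr M X (- (D - {y})) x z * green_upto D N z y \<partial>count_space (D - (D - {y})))"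
    using green_upto_first_exit[of "D - {y}" D y N x] assms by simp
  also have "D - (D - {y}) = {y}" using assms by auto
  also have "(\<integral>\<^sup>+z. hitting_distr M X (- (D - {y})) x z * green_upto D N z y \<partial>count_space {y})
      = hitting_distr M X (- (D - {y})) x y * green_upto D N y y"
    by (simp add: nn_integral_count_space_finite)
  also have "\<dots> \<le> 1 * green_upto D N y y"
    unfolding hitting_distr_def by (intro mult_right_mono emeasure_le_1) auto
  finally show ?thesis by simp
qed

text \<open>To visit \<open>y\<close> in \<open>B\<close>, the walk must leave \<open>A\<close>
  through a point of \<open>B\<close>; from there the diagonal bound applies.\<close>

lemma green_upto_le_psi:
  assumes "A \<union> B \<union> C = UNIV" "A \<inter> B = {}" "A \<inter> C = {}" "y \<in> B"
  shows "green_upto (A \<union> B) N x y \<le> hit_psi M X A B C x * green_upto (A \<union> B) N y y"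
proof -
  have sets: "- A = B \<union> C" "A \<union> B - A = B" "y \<notin> A" using assms by auto
  have "green_upto (A \<union> B) N x y
      \<le> (\<integral>\<^sup>+z. hitting_distr M X (B \<union> C) x z * green_upto (A \<union> B) N z y \<partial>count_space B)"
    using green_upto_first_exit[of A "A \<union> B" y N x] assms(4) by (simp add: sets)
  also have "\<dots> \<le> (\<integral>\<^sup>+z. hitting_distr M X (B \<union> C) x z * green_upto (A \<union> B) N y y \<partial>count_space B)"
    using assms(4) by (intro nn_integral_mono mult_left_mono green_upto_le_diag) auto
  also have "\<dots> = hit_psi M X A B C x * green_upto (A \<union> B) N y y"
    by (simp add: hit_psi_def infsum_ennreal_eq_nn_integral nn_integral_multc)
  finally show ?thesis .
qed

text \<open>Exchanging \<open>A\<close> and \<open>B\<close> exchanges psi with sigma and rho with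
  phi, so one half of the bounds yields the other.\<close>

lemma hit_sigma_swap: "hit_sigma M X A B C = hit_psi M X B A C"
  by (simp add: fun_eq_iff hit_sigma_def hit_psi_def)

lemma hit_phi_swap: "hit_phi M X A B C = hit_rho M X B A C"
  by (simp add: fun_eq_iff hit_phi_def hit_rho_def hit_sigma_swap)

text \<open>Paths that leave \<open>A\<close> cross twice: into \<open>B\<close> at
  \<open>z\<close>, then back to \<open>A\<close> with the factor sigma at \<open>z\<close>. Summing
  over \<open>z\<close> gives rho.\<close>

lemma green_upto_le_rho:
  assumes "A \<union> B \<union> C = UNIV" "A \<inter> B = {}" "A \<inter> C = {}" "B \<inter> C = {}" "y \<in> A"
  shows "green_upto (A \<union> B) N x y
    \<le> green_upto A N x y + hit_rho M X A B C x * green_upto (A \<union> B) N y y"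
proof -
  have sets: "- A = B \<union> C" "A \<union> B - A = B" using assms by auto
  have sigma: "green_upto (A \<union> B) N z y \<le> hit_sigma M X A B C z * green_upto (A \<union> B) N y y" for z
    using green_upto_le_psi[of B A C y N z] assms by (simp add: hit_sigma_swap Un_commute Int_commute)
  have "green_upto (A \<union> B) N x y \<le> green_upto A N x y +
      (\<integral>\<^sup>+z. hitting_distr M X (B \<union> C) x z * green_upto (A \<union> B) N z y \<partial>count_space B)"
    using green_upto_first_exit[of A "A \<union> B" y N x] assms(5) by (simp add: sets)
  also have "\<dots> \<le> green_upto A N x y + (\<integral>\<^sup>+z. hitting_distr M X (B \<union> C) x z *
      (hit_sigma M X A B C z * green_upto (A \<union> B) N y y) \<partial>count_space B)"
    by (intro add_left_mono nn_integral_mono mult_left_mono sigma) auto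
  also have "\<dots> = green_upto A N x y + hit_rho M X A B C x * green_upto (A \<union> B) N y y"
    by (simp add: hit_rho_def infsum_ennreal_eq_nn_integral nn_integral_multc mult.assoc[symmetric])
  finally show ?thesis .
qed

text \<open>For equal end points the preceding bound has the same finite quantity on both sides and
  can be solved for it.\<close>

lemma green_upto_diag_le:
  assumes "A \<union> B \<union> C = UNIV" "A \<inter> B = {}" "A \<inter> C = {}" "B \<inter> C = {}" "y \<in> A"
  shows "green_upto (A \<union> B) N y y \<le> green M X A y y / (1 - hit_rho M X A B C y)"
proof (rule ennreal_le_divide_one_minus)
  show "green_upto (A \<union> B) N y y
      \<le> green M X A y y + hit_rho M X A B C y * green_upto (A \<union> B) N y y"
    using green_upto_le_rho[OF assms, of N y] green_upto_le_green[OF assms(5,5), of N]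
    by (meson add_right_mono order_trans)
  show "green M X A y y \<noteq> 0"
    using green_diag_ge_1[OF assms(5)] by auto
qed (rule green_upto_less_top)

section \<open>Passage to the full Green's functions\<close>

lemma green_union_le:
  assumes "A \<union> B \<union> C = UNIV" "A \<inter> B = {}" "A \<inter> C = {}" "B \<inter> C = {}" "x \<in> A" "y \<in> A"
  shows "green M X (A \<union> B) x y
    \<le> green M X A x y + hit_rho M X A B C x / (1 - hit_rho M X A B C y) * green M X A y y"
\<comment> \<open>The right side does not depend on \<open>N\<close>, so bounding every truncation
  suffices.\<close>
proof (rule green_leI)
  fix N
  have "green_upto (A \<union> B) N x y
      \<le> green_upto A N x y + hit_rho M X A B C x * green_upto (A \<union> B) N y y"
    using assms by (intro green_upto_le_rho)
  also have "\<dots> \<le> green M X A x y +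
      hit_rho M X A B C x * (green M X A y y / (1 - hit_rho M X A B C y))"
    using assms by (intro add_mono mult_left_mono green_upto_le_green green_upto_diag_le) auto
  finally show "green_upto (A \<union> B) N x y
      \<le> green M X A x y + hit_rho M X A B C x / (1 - hit_rho M X A B C y) * green M X A y y"
    by (simp add: divide_ennreal_def mult_ac)
qed (use assms in auto)

lemma green_union_cross_le:
  assumes "A \<union> B \<union> C = UNIV" "A \<inter> B = {}" "A \<inter> C = {}" "B \<inter> C = {}" "x \<in> A" "y \<in> B"
  shows "green M X (A \<union> B) x y
    \<le> hit_psi M X A B C x / (1 - hit_phi M X A B C y) * green M X B y y"
proof (rule green_leI)
  fix N
  have "green_upto (A \<union> B) N x y \<le> hit_psi M X A B C x * green_upto (A \<union> B) N y y"
    using assms by (intro green_upto_le_psi)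
  \<comment> \<open>The diagonal bound with \<open>A\<close> and \<open>B\<close> exchanged, where
    phi replaces rho.\<close>
  also have "\<dots> \<le> hit_psi M X A B C x * (green M X B y y / (1 - hit_phi M X A B C y))"
    using green_upto_diag_le[of B A C y N] assms
    by (intro mult_left_mono) (auto simp: hit_phi_swap Un_commute Int_commute)
  finally show "green_upto (A \<union> B) N x y
      \<le> hit_psi M X A B C x / (1 - hit_phi M X A B C y) * green M X B y y"
    by (simp add: divide_ennreal_def mult_ac)
qed (use assms in auto)

end

theorem proposition1:
  fixes M :: "'w measure"
    and X :: "nat \<Rightarrow> 'w \<Rightarrow> 'a :: {ab_group_add, countable}"
    and A B C :: "'a set"
    and a a' b b' :: 'a
  assumes "random_walk M X"
    and "A \<union> B \<union> C = UNIV" "A \<inter> B = {}" "A \<inter> C = {}" "B \<inter> C = {}"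
    and "a \<in> A" "a' \<in> A" "b \<in> B" "b' \<in> B"
  shows
    "(green M X A a a' \<le> green M X (A \<union> B) a a' \<and>
      green M X (A \<union> B) a a' \<le>
        green M X A a a' + hit_rho M X A B C a / (1 - hit_rho M X A B C a') * green M X A a' a') \<and>
     (green M X B b b' \<le> green M X (A \<union> B) b b' \<and>
      green M X (A \<union> B) b b' \<le>
        green M X B b b' + hit_phi M X A B C b / (1 - hit_phi M X A B C b') * green M X B b' b') \<and>
     (0 \<le> green M X (A \<union> B) a b \<and>
      green M X (A \<union> B) a b \<le> hit_psi M X A B C a / (1 - hit_phi M X A B C b) * green M X B b b \<and>
      (symmetric_walk M X \<longrightarrow>
         green M X (A \<union> B) a b \<le>
           min (hit_sigma M X A B C b / (1 - hit_rho M X A B C a) * green M X A a a)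
               (hit_psi M X A B C a / (1 - hit_phi M X A B C b) * green M X B b b)))"
proof -
  interpret random_walk M X by (rule assms(1))
  have swap: "B \<union> A \<union> C = UNIV" "B \<inter> A = {}" "A \<union> B = B \<union> A"
    using assms by auto
  have bb: "green M X (A \<union> B) b b'
      \<le> green M X B b b' + hit_phi M X A B C b / (1 - hit_phi M X A B C b') * green M X B b' b'"
    using green_union_le[OF swap(1,2) assms(5,4,8,9)] by (simp add: hit_phi_swap Un_commute)
  have ab: "green M X (A \<union> B) a b
      \<le> hit_psi M X A B C a / (1 - hit_phi M X A B C b) * green M X B b b"
    by (rule green_union_cross_le[OF assms(2-6,8)])
  \<comment> \<open>Symmetry replaces paths from \<open>a\<close> to \<open>b\<close> by paths from
    \<open>b\<close> to \<open>a\<close>, to which the cross bound with exchanged sets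
    applies.\<close>
  have ba: "green M X (A \<union> B) a b
      \<le> hit_sigma M X A B C b / (1 - hit_rho M X A B C a) * green M X A a a"
    if "symmetric_walk M X"
    using green_union_cross_le[OF swap(1,2) assms(5,4,8,6)] green_sym[OF that, of "A \<union> B" a b]
    by (simp add: hit_phi_swap hit_sigma_swap Un_commute)
  show ?thesis
    using green_union_le[OF assms(2-7)] bb ab ba by (auto intro!: green_mono)
qed

end
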